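(* Let $C$, $X$, $Z$, $\mu_0'$, $\mu_1'$, the set $\mathcal D$ and the maximal information leakage $I_\infty(C;Z)$ be as defined in the context, and assume $\mu_0'<\mu_1'$. Then the solution to the minimization of maximal information leakage, $(\beta_0^*,\beta_1^* )=\operatorname*{arg\,min}_{(\beta_0,\beta_1)\in\mathcal D}I_\infty(C;Z)$, is equal to $$(\beta_0^*,\beta_1^* )=\operatorname*{arg\,min}_{(\beta_0,\beta_1)\in\mathcal D}\log\Big(2\,Q\Big(\frac{\mu_0'-\mu_1'}{2\sigma}\Big)\Big)=\operatorname*{arg\,max}_{(\beta_0,\beta_1)\in\mathcal D}\Big(\frac{\mu_0'-\mu_1'}{2\sigma}\Big),$$ and the solutions $\beta_0^*,\beta_1^*$ are given by $$\beta_0^*=\sqrt{\frac{\tilde p}{1-\tilde p}D},\quad \beta_1^*=\sqrt{\frac{1-\tilde p}{\tilde p}D}\qquad\text{if } D\le\tilde p(1-\tilde p)(\mu_1-\mu_0)^2,$$ and by $$\beta_0^*=(\mu_1-\mu_0)(1-\tilde p),\quad \beta_1^*=(\mu_1-\mu_0)\tilde p\qquad\text{otherwise.}$$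
   Context: Let $\mu_0\le\mu_1$ be real numbers, $\sigma>0$, $\tilde p\in(0,1)$, $D\ge0$. $C\in\{0,1\}$ is a private label with $P(C=0)=\tilde p$, $P(C=1)=1-\tilde p$. Given $C=0$, $X\sim\mathcal N(\mu_0,\sigma^2)$; given $C=1$, $X\sim\mathcal N(\mu_1,\sigma^2)$. For parameters $\beta_0,\beta_1\ge 0$ the disclosed variable is $Z=X+(1-C)\beta_0-C\beta_1$, so that $Z\mid C=0\sim\mathcal N(\mu_0',\sigma^2)$ and $Z\mid C=1\sim\mathcal N(\mu_1',\sigma^2)$ with $\mu_0'=\mu_0+\beta_0$, $\mu_1'=\mu_1-\beta_1$; the parameters are required to satisfy $\mu_0'\le\mu_1'$ throughout. The distortion set is $$\mathcal D=\{(\beta_0,\beta_1):\ (1-\tilde p)\beta_0^2+\tilde p\,\beta_1^2\le D,\ \beta_0\ge 0,\ \beta_1\ge 0\}.$$ The maximal information leakage (Sibson mutual information of order $\infty$) from $C$ to $Z$ is $I_\infty(C;Z)=\log\int_{\mathbb R}\max_{c\in\{0,1\}}p_{Z|C=c}(z)\,dz$, where $p_{Z|C=c}$ is the conditional density of $Z$ given $C=c$. $Q(x)=\frac1{\sqrt{2\pi}}\int_x^\infty e^{-u^2/2}\,du$.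
   Formalization: The "otherwise" pair can violate the distortion bound; shown instead: ((μ1-μ0)p, (μ1-μ0)(1-p)) is a minimizer (not always unique), and the printed pair is one iff it lies in the distortion set. The minimization is over μ0' ≤ μ1', not strict, since the optimum there has μ0' = μ1'. *)

theory Defs
  imports "HOL-Probability.Probability"
begin

definition cond_density :: "'a measure \<Rightarrow> ('a \<Rightarrow> nat) \<Rightarrow> ('a \<Rightarrow> real) \<Rightarrow> nat \<Rightarrow> real \<Rightarrow> real" where
  "cond_density M C Z c z =
     enn2real (RN_deriv lborel
       (distr (uniform_measure M {\<omega> \<in> space M. C \<omega> = c}) lborel Z) z)"

text \<open>Sibson mutual information of order infinity, for a label with values in \<open>{0, 1}\<close>;
  the logarithm is natural.\<close>

definition max_leakage :: "'a measure \<Rightarrow> ('a \<Rightarrow> nat) \<Rightarrow> ('a \<Rightarrow> real) \<Rightarrow> real" where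
  "max_leakage M C Z = ln (\<integral>z. (MAX c\<in>{0, 1}. cond_density M C Z c z) \<partial>lborel)"

definition disclosed :: "('a \<Rightarrow> nat) \<Rightarrow> ('a \<Rightarrow> real) \<Rightarrow> real \<Rightarrow> real \<Rightarrow> 'a \<Rightarrow> real" where
  "disclosed C X \<beta>0 \<beta>1 \<omega> = X \<omega> + (1 - real (C \<omega>)) * \<beta>0 - real (C \<omega>) * \<beta>1"

definition Qfun :: "real \<Rightarrow> real" where
  "Qfun x = 1 / sqrt (2 * pi) * (LBINT u:{x..}. exp (- (u\<^sup>2 / 2)))"

definition distortion_set :: "real \<Rightarrow> real \<Rightarrow> (real \<times> real) set" where
  "distortion_set p D =
     {(\<beta>0, \<beta>1). (1 - p) * \<beta>0\<^sup>2 + p * \<beta>1\<^sup>2 \<le> D \<and> \<beta>0 \<ge> 0 \<and> \<beta>1 \<ge> 0}"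

text \<open>The standing requirement that the shifted means stay ordered.  It is not strict: at the
  optimum with \<open>D \<ge> p * (1 - p) * (\<mu>1 - \<mu>0)\<^sup>2\<close> the two shifted means coincide.\<close>

definition ordered_means :: "real \<Rightarrow> real \<Rightarrow> (real \<times> real) set" where
  "ordered_means \<mu>0 \<mu>1 = {(\<beta>0, \<beta>1). \<mu>0 + \<beta>0 \<le> \<mu>1 - \<beta>1}"

definition arg_mins :: "('b \<Rightarrow> real) \<Rightarrow> 'b set \<Rightarrow> 'b set" where
  "arg_mins f S = {x. is_arg_min f (\<lambda>y. y \<in> S) x}"

definition arg_maxs :: "('b \<Rightarrow> real) \<Rightarrow> 'b set \<Rightarrow> 'b set" where
  "arg_maxs f S = {x. is_arg_max f (\<lambda>y. y \<in> S) x}"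

text \<open>For \<open>D > p * (1 - p) * (\<mu>1 - \<mu>0)\<^sup>2\<close> the source gives the solution as
  \<open>((\<mu>1 - \<mu>0) * (1 - p), (\<mu>1 - \<mu>0) * p)\<close>.  This pair need not lie in the distortion set,
  as the following instance shows; with the factors \<open>p\<close> and \<open>1 - p\<close> exchanged it always does,
  and it is then optimal.\<close>

lemma printed_pair_infeasible:
  fixes \<mu>0 \<mu>1 p D :: real
  assumes "\<mu>0 = 0" "\<mu>1 = 1" "p = 1/4" "D = 1/4"
  shows "D > p * (1 - p) * (\<mu>1 - \<mu>0)\<^sup>2"
    and "((\<mu>1 - \<mu>0) * (1 - p), (\<mu>1 - \<mu>0) * p) \<notin> distortion_set p D"
    and "((\<mu>1 - \<mu>0) * p, (\<mu>1 - \<mu>0) * (1 - p)) \<in> distortion_set p D"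
  unfolding assms by (simp_all add: distortion_set_def power2_eq_square)

end

theory Submission imports Defs begin

text \<open>The larger of the two shifted Gaussian densities switches at the midpoint of the means, so its
  integral is twice a Gaussian tail.  The leakage is therefore a strictly increasing function of the
  gap between the means, and minimising it means maximising \<open>\<beta>0 + \<beta>1\<close>.  By the Cauchy--Schwarz
  identity
  \<open>p (1 - p) (x + y)\<^sup>2 + ((1 - p) x - p y)\<^sup>2 = (1 - p) x\<^sup>2 + p y\<^sup>2\<close>
  this sum is at most \<open>sqrt (D / (p (1 - p)))\<close>, with equality only when \<open>(1 - p) x = p y\<close>; if this
  bound exceeds \<open>\<mu>1 - \<mu>0\<close>, the means can be made to coincide.\<close>

section \<open>Transfer of optimisers between objectives with matching strict comparisons\<close>

lemma arg_mins_order_cong: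
  assumes "\<And>x y. x \<in> S \<Longrightarrow> y \<in> S \<Longrightarrow> f x < f y \<longleftrightarrow> g x < g y"
  shows "arg_mins f S = arg_mins g S"
  using assms unfolding arg_mins_def is_arg_min_def by blast

lemma arg_mins_eq_arg_maxs:
  assumes "\<And>x y. x \<in> S \<Longrightarrow> y \<in> S \<Longrightarrow> f x < f y \<longleftrightarrow> g y < g x"
  shows "arg_mins f S = arg_maxs g S"
  using assms unfolding arg_mins_def arg_maxs_def is_arg_min_def is_arg_max_def by blast

section \<open>Gaussian tails and the integral of a maximum of two normal densities\<close>

lemma Qfun_std_normal:
  "Qfun x = (\<integral>u. indicator {x..} u * std_normal_density u \<partial>lborel)"
  unfolding Qfun_def set_lebesgue_integral_def std_normal_density_def
  by (simp flip: integral_mult_right_zero add: mult_ac)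

lemma integrable_indicator_normal_density:
  fixes A :: "real set"
  assumes "0 < \<sigma>" "A \<in> sets borel"
  shows "integrable lborel (\<lambda>u. indicator A u * normal_density \<mu> \<sigma> u)"
  using integrable_real_mult_indicator[of A lborel "normal_density \<mu> \<sigma>"] assms
  by (simp add: mult.commute)

text \<open>The difference of the tails is the mass of \<open>{x..<y}\<close>. The density is
  positive everywhere, so zero mass would make this interval a null set.\<close>

lemma Qfun_strict_antimono:
  assumes "x < y"
  shows "Qfun y < Qfun x"
proof -
  let ?f = "\<lambda>u. indicator {x..} u * std_normal_density u - indicator {y..} u * std_normal_density u"
  have int: "integrable lborel ?f"
    by (intro Bochner_Integration.integrable_diff integrable_indicator_normal_density) auto
  have diff: "(\<integral>u. ?f u \<partial>lborel) = Qfun x - Qfun y"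
    unfolding Qfun_std_normal
    by (intro Bochner_Integration.integral_diff integrable_indicator_normal_density) auto
  have nonneg: "0 \<le> ?f u" for u using assms by (auto simp: indicator_def)
  have "(\<integral>u. ?f u \<partial>lborel) \<noteq> 0"
  proof
    assume "(\<integral>u. ?f u \<partial>lborel) = 0"
    then have "AE u in lborel. ?f u = 0"
      using integral_nonneg_eq_0_iff_AE[OF int] nonneg by simp
    then have "AE u in lborel. u \<notin> {x..<y}"
    proof eventually_elim
      case (elim u)
      have "0 < std_normal_density u" by (simp add: normal_density_pos)
      then show ?case using elim by (auto simp: indicator_def)
    qed
    then have "emeasure lborel {x..<y} = 0" by (subst (asm) AE_iff_measurable) auto
    then show False using assms by simp
  qed
  moreover have "0 \<le> (\<integral>u. ?f u \<partial>lborel)" using nonneg by (intro integral_nonneg_AE) auto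
  ultimately show ?thesis unfolding diff by simp
qed

text \<open>Strict decrease puts \<open>Qfun x\<close> above a nonnegative value; positivity lets
  \<open>ln\<close> preserve strict comparisons later.\<close>

lemma Qfun_pos: "0 < Qfun x"
proof -
  have "0 \<le> Qfun (x + 1)"
    unfolding Qfun_std_normal by (intro integral_nonneg_AE) auto
  also have "\<dots> < Qfun x" by (rule Qfun_strict_antimono) simp
  finally show ?thesis .
qed

lemma normal_upper_tail:
  assumes "0 < \<sigma>"
  shows "(\<integral>z. indicator {a..} z * normal_density \<mu> \<sigma> z \<partial>lborel) = Qfun ((a - \<mu>) / \<sigma>)"
proof -
  \<comment> \<open>The leading factor \<open>\<sigma>\<close> is the Jacobian of the substitution
    \<open>z = \<mu> + \<sigma> * u\<close>.\<close>
  have eq: "\<sigma> * (indicator {a..} (\<mu> + \<sigma> * u) * normal_density \<mu> \<sigma> (\<mu> + \<sigma> * u))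
      = indicator {(a - \<mu>) / \<sigma>..} u * std_normal_density u" for u
    using assms by (auto simp: indicator_def normal_density_def field_simps real_sqrt_mult)
  show ?thesis
    unfolding Qfun_std_normal
    using assms by (subst lborel_integral_real_affine[where c = \<sigma> and t = \<mu>])
      (simp_all flip: eq)
qed

text \<open>The reflected substitution \<open>z = \<mu> - \<sigma> * u\<close> turns the lower tail
  into an upper one.\<close>

lemma normal_lower_tail:
  assumes "0 < \<sigma>"
  shows "(\<integral>z. indicator {..a} z * normal_density \<mu> \<sigma> z \<partial>lborel) = Qfun ((\<mu> - a) / \<sigma>)"
proof -
  have "\<mu> + - \<sigma> * u \<le> a \<longleftrightarrow> (\<mu> - a) / \<sigma> \<le> u" for u
    using assms by (simp add: pos_divide_le_eq) (simp add: algebra_simps)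
  moreover have "\<sigma> * normal_density \<mu> \<sigma> (\<mu> + - \<sigma> * u) = std_normal_density u" for u
    using assms by (simp add: normal_density_def power_mult_distrib real_sqrt_mult)
  ultimately have eq: "\<sigma> * (indicator {..a} (\<mu> + - \<sigma> * u) * normal_density \<mu> \<sigma> (\<mu> + - \<sigma> * u))
      = indicator {(\<mu> - a) / \<sigma>..} u * std_normal_density u" for u
    by (simp add: indicator_def)
  show ?thesis
    unfolding Qfun_std_normal
    using assms by (subst lborel_integral_real_affine[where c = "- \<sigma>" and t = \<mu>])
      (simp_all flip: eq)
qed

lemma normal_density_le_iff:
  assumes "0 < \<sigma>"
  shows "normal_density a \<sigma> z \<le> normal_density b \<sigma> z \<longleftrightarrow> (z - b)\<^sup>2 \<le> (z - a)\<^sup>2"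
proof -
  \<comment> \<open>Closes the branch for a negative scale factor in the cancellation rules.\<close>
  have "\<not> pi * \<sigma>\<^sup>2 < 0" using assms by (simp add: not_less)
  then show ?thesis
    using assms by (simp add: normal_density_def divide_le_cancel mult_le_cancel_left)
qed

lemma integral_max_normal_density:
  assumes \<sigma>: "0 < \<sigma>" and "a \<le> b"
  shows "(\<integral>z. max (normal_density a \<sigma> z) (normal_density b \<sigma> z) \<partial>lborel)
    = 2 * Qfun ((a - b) / (2 * \<sigma>))"
proof -
  let ?m = "(a + b) / 2"
  \<comment> \<open>The quadratic terms in \<open>z\<close> cancel; what remains is linear with its
    zero at the midpoint, so its sign is known on each side.\<close>
  have sq: "(z - b)\<^sup>2 - (z - a)\<^sup>2 = 2 * (b - a) * (?m - z)" for z
    by (simp add: power2_eq_square field_simps)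
  have below: "max (normal_density a \<sigma> z) (normal_density b \<sigma> z) = normal_density a \<sigma> z"
    if "z < ?m" for z
  proof -
    have "0 \<le> 2 * (b - a) * (?m - z)" using assms that by (intro mult_nonneg_nonneg) auto
    then have "(z - a)\<^sup>2 \<le> (z - b)\<^sup>2" using sq[of z] by linarith
    then show ?thesis using normal_density_le_iff[OF \<sigma>] by (simp add: max_absorb1)
  qed
  have above: "max (normal_density a \<sigma> z) (normal_density b \<sigma> z) = normal_density b \<sigma> z"
    if "?m < z" for z
  proof -
    have "2 * (b - a) * (?m - z) \<le> 0" using assms that by (intro mult_nonneg_nonpos) auto
    then have "(z - b)\<^sup>2 \<le> (z - a)\<^sup>2" using sq[of z] by linarith
    then show ?thesis using normal_density_le_iff[OF \<sigma>] by (simp add: max_absorb2)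
  qed
  have "(\<integral>z. max (normal_density a \<sigma> z) (normal_density b \<sigma> z) \<partial>lborel)
    = (\<integral>z. indicator {..?m} z * normal_density a \<sigma> z
        + indicator {?m..} z * normal_density b \<sigma> z \<partial>lborel)"
  proof (rule integral_cong_AE)
    \<comment> \<open>Both half-lines contain the midpoint, where the sum counts both densities; one
      point is a null set.\<close>
    show "AE z in lborel. max (normal_density a \<sigma> z) (normal_density b \<sigma> z)
        = indicator {..?m} z * normal_density a \<sigma> z + indicator {?m..} z * normal_density b \<sigma> z"
      using AE_lborel_singleton[of ?m]
    proof eventually_elim
      case (elim z)
      then show ?case using below[of z] above[of z] by (cases z ?m rule: linorder_cases) auto
    qed
  qed auto
  also have "\<dots> = Qfun ((a - ?m) / \<sigma>) + Qfun ((?m - b) / \<sigma>)"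
    using \<sigma> by (subst Bochner_Integration.integral_add)
      (simp_all only: integrable_indicator_normal_density normal_lower_tail normal_upper_tail
        atMost_borel atLeast_borel)
  \<comment> \<open>The midpoint lies half the gap away from either mean, so the two tails
    agree.\<close>
  also have "(a - ?m) / \<sigma> = (a - b) / (2 * \<sigma>)" using \<sigma> by (simp add: field_simps)
  also have "(?m - b) / \<sigma> = (a - b) / (2 * \<sigma>)" using \<sigma> by (simp add: field_simps)
  finally show ?thesis by simp
qed

section \<open>Conditional densities of the disclosed variable\<close>

lemma cond_density_AE_normal:
  fixes k :: nat
  assumes "prob_space M" and \<sigma>: "0 < \<sigma>"
    and C: "C \<in> measurable M (count_space UNIV)"
    and Z: "Z \<in> borel_measurable M"
    and pos: "0 < measure M {\<omega> \<in> space M. C \<omega> = k}"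
    and X: "distributed (uniform_measure M {\<omega> \<in> space M. C \<omega> = k}) lborel X (normal_density \<mu> \<sigma>)"
    and shift: "\<And>\<omega>. \<omega> \<in> space M \<Longrightarrow> C \<omega> = k \<Longrightarrow> Z \<omega> = t + X \<omega>"
  shows "AE z in lborel. cond_density M C Z k z = normal_density (t + \<mu>) \<sigma> z"
proof -
  interpret prob_space M by fact
  define A where "A = {\<omega> \<in> space M. C \<omega> = k}"
  have A: "A \<in> sets M" unfolding A_def using C by measurable
  have U: "prob_space (uniform_measure M A)"
    using pos by (intro prob_space_uniform_measure) (auto simp: A_def emeasure_eq_measure)
  have "distributed (uniform_measure M A) lborel (\<lambda>\<omega>. t + 1 * X \<omega>)
      (normal_density (t + 1 * \<mu>) (\<bar>1\<bar> * \<sigma>))"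
    using X \<sigma> by (intro prob_space.normal_density_affine[OF U]) (auto simp: A_def)
  then have tX: "distributed (uniform_measure M A) lborel (\<lambda>\<omega>. t + X \<omega>)
      (normal_density (t + \<mu>) \<sigma>)" by simp
  have "distr (uniform_measure M A) lborel Z = distr (uniform_measure M A) lborel (\<lambda>\<omega>. t + X \<omega>)"
  proof (rule distr_cong_AE)
    \<comment> \<open>The conditioned measure lives on \<open>A\<close>, and only there is
      \<open>Z\<close> a translate of \<open>X\<close>.\<close>
    show "AE \<omega> in uniform_measure M A. Z \<omega> = t + X \<omega>"
      using A shift by (intro AE_uniform_measureI) (auto simp: A_def)
  qed (use Z distributed_measurable[OF tX] in auto)
  also have "\<dots> = density lborel (normal_density (t + \<mu>) \<sigma>)"
    by (rule distributed_distr_eq_density[OF tX])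
  finally have "density lborel (normal_density (t + \<mu>) \<sigma>)
      = distr (uniform_measure M A) lborel Z" by simp
  \<comment> \<open>A Radon-Nikodym derivative is unique only up to null sets, hence the
    almost-everywhere conclusion.\<close>
  then have "AE z in lborel. ennreal (normal_density (t + \<mu>) \<sigma> z)
      = RN_deriv lborel (distr (uniform_measure M A) lborel Z) z"
    by (intro sigma_finite_measure.RN_deriv_unique sigma_finite_lborel) auto
  then show ?thesis
  proof eventually_elim
    case (elim z)
    then show ?case by (simp add: cond_density_def flip: A_def elim)
  qed
qed

section \<open>Maximising the sum under the distortion constraint\<close>

lemma weighted_sum_identity:
  fixes p x y :: real
  shows "p * (1 - p) * (x + y)\<^sup>2 + ((1 - p) * x - p * y)\<^sup>2 = (1 - p) * x\<^sup>2 + p * y\<^sup>2"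
  by algebra

lemma distortion_sum_le:
  fixes p x y :: real
  assumes p: "0 < p" "p < 1" and le: "(1 - p) * x\<^sup>2 + p * y\<^sup>2 \<le> D"
  shows "x + y \<le> sqrt (p / (1 - p) * D) + sqrt ((1 - p) / p * D)" (is "_ \<le> ?u + ?v")
    and "x + y = sqrt (p / (1 - p) * D) + sqrt ((1 - p) / p * D) \<Longrightarrow>
      x = sqrt (p / (1 - p) * D) \<and> y = sqrt ((1 - p) / p * D)"
proof -
  have "0 \<le> (1 - p) * x\<^sup>2 + p * y\<^sup>2" using p by simp
  then have D: "0 \<le> D" using le by linarith
  have sq: "(1 - p) * ?u\<^sup>2 = p * D" "p * ?v\<^sup>2 = (1 - p) * D" using p D by simp_all
  \<comment> \<open>Proportionality of the two roots is checked on squares: both sides square to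
    \<open>p * (1 - p) * D\<close>.\<close>
  have "((1 - p) * ?u)\<^sup>2 = (1 - p) * ((1 - p) * ?u\<^sup>2)" by algebra
  also have "\<dots> = p * (p * ?v\<^sup>2)" unfolding sq by algebra
  also have "\<dots> = (p * ?v)\<^sup>2" by algebra
  finally have ratio: "(1 - p) * ?u = p * ?v"
    using p D by (simp add: power2_eq_iff_nonneg)
  have uv: "p * (1 - p) * (?u + ?v)\<^sup>2 = D"
    using weighted_sum_identity[of p ?u ?v] sq ratio by (simp add: algebra_simps)
  have bound: "p * (1 - p) * (x + y)\<^sup>2 + ((1 - p) * x - p * y)\<^sup>2 \<le> p * (1 - p) * (?u + ?v)\<^sup>2"
    using le unfolding uv weighted_sum_identity .
  then have "p * (1 - p) * (x + y)\<^sup>2 \<le> p * (1 - p) * (?u + ?v)\<^sup>2"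
    using zero_le_power2[of "(1 - p) * x - p * y"] by linarith
  then have "(x + y)\<^sup>2 \<le> (?u + ?v)\<^sup>2" using p by simp
  then show "x + y \<le> ?u + ?v" by (rule power2_le_imp_le) (use p D in simp)
  show "x = ?u \<and> y = ?v" if eq: "x + y = ?u + ?v"
  proof -
    \<comment> \<open>Equal sums use up the whole bound and leave nothing for the second square;
      proportionality and the sum then fix the pair.\<close>
    have "((1 - p) * x - p * y)\<^sup>2 \<le> 0" using bound unfolding eq by linarith
    then have xy: "(1 - p) * x = p * y" by simp
    have "x = p * (x + y)" using xy by (simp add: algebra_simps)
    also have "\<dots> = ?u" using ratio unfolding eq by (simp add: algebra_simps)
    finally show ?thesis using eq by simp
  qed
qed

text \<open>The pair makes the constraint tight. The second bound serves to compare its sum with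
  \<open>\<mu>1 - \<mu>0\<close>, that is, to check that the means stay ordered.\<close>

lemma distortion_optimum:
  fixes p D :: real
  assumes p: "0 < p" "p < 1" and D: "0 \<le> D"
  shows "(sqrt (p / (1 - p) * D), sqrt ((1 - p) / p * D)) \<in> distortion_set p D"
    and "p * (1 - p) * (sqrt (p / (1 - p) * D) + sqrt ((1 - p) / p * D))\<^sup>2 \<le> D"
proof -
  let ?u = "sqrt (p / (1 - p) * D)" and ?v = "sqrt ((1 - p) / p * D)"
  have "(1 - p) * ?u\<^sup>2 = p * D" "p * ?v\<^sup>2 = (1 - p) * D" using p D by simp_all
  then have eq: "(1 - p) * ?u\<^sup>2 + p * ?v\<^sup>2 = D" by (simp add: algebra_simps)
  show "(?u, ?v) \<in> distortion_set p D" using eq p D by (simp add: distortion_set_def)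
  show "p * (1 - p) * (?u + ?v)\<^sup>2 \<le> D"
    using weighted_sum_identity[of p ?u ?v] zero_le_power2[of "(1 - p) * ?u - p * ?v"] eq
    by linarith
qed

text \<open>For large \<open>D\<close> several feasible pairs can make the means coincide, and each
  is optimal. That case therefore asserts membership rather than a singleton, and the unexchanged
  pair is optimal exactly when feasible.\<close>

theorem mainTheorem3:
  fixes M :: "'a measure" and C :: "'a \<Rightarrow> nat" and X :: "'a \<Rightarrow> real"
    and \<mu>0 \<mu>1 \<sigma> p D :: real
  assumes "prob_space M"
    and "\<mu>0 \<le> \<mu>1" and "\<sigma> > 0" and "0 < p" and "p < 1" and "D \<ge> 0"
    and "C \<in> measurable M (count_space UNIV)"
    and "X \<in> borel_measurable M"
    and "\<And>\<omega>. \<omega> \<in> space M \<Longrightarrow> C \<omega> \<in> {0, 1}"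
    and "measure M {\<omega> \<in> space M. C \<omega> = 0} = p"
    and "measure M {\<omega> \<in> space M. C \<omega> = 1} = 1 - p"
    and "distributed (uniform_measure M {\<omega> \<in> space M. C \<omega> = 0}) lborel X (normal_density \<mu>0 \<sigma>)"
    and "distributed (uniform_measure M {\<omega> \<in> space M. C \<omega> = 1}) lborel X (normal_density \<mu>1 \<sigma>)"
  defines "S \<equiv> distortion_set p D \<inter> ordered_means \<mu>0 \<mu>1"
    and "I \<equiv> (\<lambda>(\<beta>0, \<beta>1). max_leakage M C (disclosed C X \<beta>0 \<beta>1))"
  shows "arg_mins I S =
           arg_mins (\<lambda>(\<beta>0, \<beta>1). ln (2 * Qfun (((\<mu>0 + \<beta>0) - (\<mu>1 - \<beta>1)) / (2 * \<sigma>)))) S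
       \<and> arg_mins I S =
           arg_maxs (\<lambda>(\<beta>0, \<beta>1). ((\<mu>0 + \<beta>0) - (\<mu>1 - \<beta>1)) / (2 * \<sigma>)) S
       \<and> (D \<le> p * (1 - p) * (\<mu>1 - \<mu>0)\<^sup>2 \<longrightarrow>
           arg_mins I S = {(sqrt (p / (1 - p) * D), sqrt ((1 - p) / p * D))})
       \<and> (D > p * (1 - p) * (\<mu>1 - \<mu>0)\<^sup>2 \<longrightarrow>
           ((\<mu>1 - \<mu>0) * p, (\<mu>1 - \<mu>0) * (1 - p)) \<in> arg_mins I S
         \<and> (((\<mu>1 - \<mu>0) * (1 - p), (\<mu>1 - \<mu>0) * p) \<in> arg_mins I S \<longleftrightarrow>
             ((\<mu>1 - \<mu>0) * (1 - p), (\<mu>1 - \<mu>0) * p) \<in> distortion_set p D))"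
proof -
  let ?gap = "\<lambda>(\<beta>0, \<beta>1). ((\<mu>0 + \<beta>0) - (\<mu>1 - \<beta>1)) / (2 * \<sigma>)"
  let ?L = "\<lambda>(\<beta>0, \<beta>1). ln (2 * Qfun (((\<mu>0 + \<beta>0) - (\<mu>1 - \<beta>1)) / (2 * \<sigma>)))"
  let ?sum = "\<lambda>(x :: real, y). x + y"
  note \<sigma> = \<open>\<sigma> > 0\<close>
  note p = \<open>0 < p\<close> \<open>p < 1\<close>
  \<comment> \<open>Restricted to \<open>S\<close> because the formula for the integrated maximum
    requires ordered means.\<close>
  have I_eq: "I b = ?L b" if "b \<in> S" for b
  proof -
    obtain x y where b: "b = (x, y)" by (cases b)
    let ?Z = "disclosed C X x y"
    note [measurable] = assms(7,8)
    have Z: "?Z \<in> borel_measurable M" unfolding disclosed_def[abs_def] by measurable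
    \<comment> \<open>The translation is by \<open>x\<close> under label 0 and by \<open>- y\<close>
      under label 1.\<close>
    have d0: "AE z in lborel. cond_density M C ?Z 0 z = normal_density (x + \<mu>0) \<sigma> z"
      by (rule cond_density_AE_normal[OF assms(1) \<sigma> assms(7) Z _ assms(12)])
        (use p assms(10) in \<open>auto simp: disclosed_def\<close>)
    have d1: "AE z in lborel. cond_density M C ?Z 1 z = normal_density (- y + \<mu>1) \<sigma> z"
      by (rule cond_density_AE_normal[OF assms(1) \<sigma> assms(7) Z _ assms(13)])
        (use p assms(11) in \<open>auto simp: disclosed_def\<close>)
    have "(\<integral>z. (MAX c\<in>{0, 1}. cond_density M C ?Z c z) \<partial>lborel)
        = (\<integral>z. max (normal_density (x + \<mu>0) \<sigma> z) (normal_density (- y + \<mu>1) \<sigma> z) \<partial>lborel)"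
    proof (rule integral_cong_AE)
      show "(\<lambda>z. MAX c\<in>{0, 1}. cond_density M C ?Z c z) \<in> borel_measurable lborel"
        unfolding cond_density_def by simp
      show "AE z in lborel. (MAX c\<in>{0, 1}. cond_density M C ?Z c z)
          = max (normal_density (x + \<mu>0) \<sigma> z) (normal_density (- y + \<mu>1) \<sigma> z)"
        using d0 d1 by eventually_elim simp
    qed simp
    also have "\<dots> = 2 * Qfun ((x + \<mu>0 - (- y + \<mu>1)) / (2 * \<sigma>))"
      using that \<sigma> by (intro integral_max_normal_density) (auto simp: S_def b ordered_means_def)
    finally show ?thesis by (simp add: I_def b max_leakage_def algebra_simps)
  qed
  \<comment> \<open>\<open>Qfun\<close> is strictly decreasing and \<open>ln\<close> strictly
    increasing, so comparisons reverse.\<close>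
  have L_less: "?L b < ?L c \<longleftrightarrow> ?gap c < ?gap b" for b c
  proof -
    have "ln (2 * Qfun u) < ln (2 * Qfun v) \<longleftrightarrow> v < u" for u v
      using Qfun_strict_antimono[of u v] Qfun_strict_antimono[of v u] Qfun_pos[of u] Qfun_pos[of v]
      by (cases u v rule: linorder_cases) auto
    then show ?thesis by (cases b; cases c) simp
  qed
  \<comment> \<open>\<open>?gap\<close> is the sum shifted by a constant and divided by the positive
    \<open>2 * \<sigma>\<close>.\<close>
  have gap_less: "?gap b < ?gap c \<longleftrightarrow> ?sum b < ?sum c" for b c
    using \<sigma> by (cases b; cases c) (simp add: divide_less_cancel algebra_simps)
  have 1: "arg_mins I S = arg_mins ?L S"
    by (rule arg_mins_order_cong) (simp only: I_eq)
  have 2: "arg_mins I S = arg_maxs ?gap S"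
    by (rule arg_mins_eq_arg_maxs) (simp only: I_eq L_less)
  have "arg_mins I S = arg_maxs ?sum S"
    by (rule arg_mins_eq_arg_maxs) (simp only: I_eq L_less gap_less)
  then have opt: "b \<in> arg_mins I S \<longleftrightarrow> b \<in> S \<and> (\<forall>c\<in>S. ?sum c \<le> ?sum b)" for b
    by (auto simp: arg_maxs_def is_arg_max_def not_less)
  have 3: "arg_mins I S = {(sqrt (p / (1 - p) * D), sqrt ((1 - p) / p * D))}" (is "_ = {(?u, ?v)}")
    if le: "D \<le> p * (1 - p) * (\<mu>1 - \<mu>0)\<^sup>2"
  proof -
    \<comment> \<open>Small \<open>D\<close> keeps the optimum of the distortion constraint alone
      within the ordering requirement.\<close>
    have "p * (1 - p) * (?u + ?v)\<^sup>2 \<le> p * (1 - p) * (\<mu>1 - \<mu>0)\<^sup>2"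
      using distortion_optimum(2)[OF p \<open>D \<ge> 0\<close>] le by linarith
    then have "(?u + ?v)\<^sup>2 \<le> (\<mu>1 - \<mu>0)\<^sup>2" using p by simp
    then have "?u + ?v \<le> \<mu>1 - \<mu>0" by (rule power2_le_imp_le) (use \<open>\<mu>0 \<le> \<mu>1\<close> in simp)
    then have uv: "(?u, ?v) \<in> S"
      using distortion_optimum(1)[OF p \<open>D \<ge> 0\<close>] by (simp add: S_def ordered_means_def)
    have le_uv: "x + y \<le> ?u + ?v" if "(x, y) \<in> S" for x y
      using that distortion_sum_le(1)[OF p, of x y D] by (simp add: S_def distortion_set_def)
    have "b = (?u, ?v)" if "b \<in> arg_mins I S" for b
    proof -
      obtain x y where b: "b = (x, y)" by (cases b)
      have xy: "(x, y) \<in> S" and "?u + ?v \<le> x + y" using that uv unfolding opt b by auto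
      then have "x + y = ?u + ?v" using le_uv by (meson antisym)
      then show ?thesis
        using xy distortion_sum_le(2)[OF p, of x y D] by (simp add: b S_def distortion_set_def)
    qed
    moreover have "(?u, ?v) \<in> arg_mins I S" using uv le_uv unfolding opt by auto
    ultimately show ?thesis by blast
  qed
  \<comment> \<open>Ordering caps every sum in \<open>S\<close> at \<open>\<mu>1 - \<mu>0\<close>,
    so a pair reaching the cap is optimal as soon as it is feasible.\<close>
  have full: "(x, y) \<in> arg_mins I S \<longleftrightarrow> (x, y) \<in> distortion_set p D"
    if "x + y = \<mu>1 - \<mu>0" for x y
    using that unfolding opt by (auto simp: S_def ordered_means_def)
  have 4: "((\<mu>1 - \<mu>0) * p, (\<mu>1 - \<mu>0) * (1 - p)) \<in> distortion_set p D"
    if "D > p * (1 - p) * (\<mu>1 - \<mu>0)\<^sup>2"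
  proof -
    \<comment> \<open>This is the proportional pair on the line of coinciding means, so its
      distortion is exactly the threshold.\<close>
    have "(1 - p) * ((\<mu>1 - \<mu>0) * p)\<^sup>2 + p * ((\<mu>1 - \<mu>0) * (1 - p))\<^sup>2 = p * (1 - p) * (\<mu>1 - \<mu>0)\<^sup>2"
      by algebra
    then show ?thesis using that p \<open>\<mu>0 \<le> \<mu>1\<close> by (simp add: distortion_set_def)
  qed
  show ?thesis
  proof (intro conjI impI)
    show "arg_mins I S = arg_mins ?L S" by (rule 1)
    show "arg_mins I S = arg_maxs ?gap S" by (rule 2)
    show "arg_mins I S = {(sqrt (p / (1 - p) * D), sqrt ((1 - p) / p * D))}"
      if "D \<le> p * (1 - p) * (\<mu>1 - \<mu>0)\<^sup>2" using that by (rule 3)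
    show "((\<mu>1 - \<mu>0) * p, (\<mu>1 - \<mu>0) * (1 - p)) \<in> arg_mins I S"
      if "D > p * (1 - p) * (\<mu>1 - \<mu>0)\<^sup>2"
      using 4[OF that] by (subst full) (simp_all add: algebra_simps)
    show "((\<mu>1 - \<mu>0) * (1 - p), (\<mu>1 - \<mu>0) * p) \<in> arg_mins I S \<longleftrightarrow>
        ((\<mu>1 - \<mu>0) * (1 - p), (\<mu>1 - \<mu>0) * p) \<in> distortion_set p D"
      by (rule full) (simp add: algebra_simps)
  qed
qed

end
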